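(* Let $q\ge1$ be an integer and, for $1\le i\le q$, let $(X_i,d_i)$ be a metric space with a quasi-order (reflexive and transitive relation) $\le_i$ on $X_i$. Put $X=\prod_{i=1}^q X_i$ and, for $x=(x_1,\dots,x_q)$ and $y=(y_1,\dots,y_q)$ in $X$, $$\Delta(x,y)=(d_1(x_1,y_1),\dots,d_q(x_q,y_q))\in\mathbb{R}_+^q,\qquad x\preceq y \iff x_i\le_i y_i \text{ for all } i\in\{1,\dots,q\}.$$ Let $T_i:X\to X_i$ ($1\le i\le q$) be maps, and let $T:X\to X$, $Tx=(T_1x,\dots,T_qx)$, be the associated selfmap. Suppose that there exists $a=(a_1,\dots,a_q)\in X$ with $a_i\le_i T_ia$ for all $i$, and that each $T_i$ is increasing ($x\preceq y$ implies $T_ix\le_i T_iy$). Assume that $d_i$ is $(\le_i)$-complete for every $i\in\{1,\dots,q\}$, and that there exists a normal $q\times q$ matrix $A=(a_{ij})$ with nonnegative real entries such that, for every $i\in\{1,\dots,q\}$, $$d_i(T_ix,T_iy)\le \sum_{j=1}^q a_{ij}\,d_j(x_j,y_j)\quad\text{for all } x,y\in X \text{ with } x\preceq y.$$ In addition, suppose that either $T_i$ is $(\Delta,\preceq)$-continuous for all $i\in\{1,\dots,q\}$, or $(\le_i)$ is $d_i$-self-closed for all $i\in\{1,\dots,q\}$. Then $T$ is a Picard operator (modulo $(\Delta,\preceq)$).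
   Context: A sequence $(u_n)$ in a set with a quasi-order is ascending if $u_n$ is less than or equal to $u_m$ (in that quasi-order) whenever $n\le m$. $d_i$ is $(\le_i)$-complete if each $(\le_i)$-ascending $d_i$-Cauchy sequence in $X_i$ is $d_i$-convergent. $(\le_i)$ is $d_i$-self-closed if the $d_i$-limit $u$ of each ($d_i$-convergent) $(\le_i)$-ascending sequence $(u_n)$ satisfies $u_n\le_i u$ for all $n$. A sequence $(x^n)$ in $X$ $\Delta$-converges to $x\in X$ if $\Delta(x^n,x)\to0$ in $\mathbb{R}^q$. $T_i$ is $(\Delta,\preceq)$-continuous if, whenever $(x^n)$ is $(\preceq)$-ascending and $\Delta$-converges to $x$, one has $d_i(T_ix^n,T_ix)\to0$ as $n\to\infty$. On $\mathbb{R}^q$, $\le$ is the componentwise order, and $z>0$ means that all components of $z$ are strictly positive. A $q\times q$ matrix $A$ with nonnegative entries is normal if $\nu(A)<1$, where $\nu(A)=\inf\{\lambda\ge0: Az\le\lambda z \text{ for some } z>0\}$; equivalently, there is $z>0$ such that every component of $Az$ is strictly less than the corresponding component of $z$. $T$ is a Picard operator (modulo $(\Delta,\preceq)$) if for each $x\in X$ with $x\preceq Tx$ the sequence $(T^nx)_{n\ge 0}$ is $\Delta$-convergent and its limit $z$ satisfies $z=Tz$. *)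

theory Defs
  imports "HOL-Analysis.Analysis"
begin

text \<open>
  The index set \<open>{1..q}\<close> is a finite type \<open>'q\<close>, so \<open>q = CARD('q) \<ge> 1\<close>. The spaces \<open>X\<^sub>i\<close> are carrier
  sets \<open>X i\<close> in one common type \<open>'a\<close> (any finite family of sets embeds into a disjoint sum), and the
  product \<open>X\<close> is \<open>Pi UNIV X\<close>.
\<close>

definition ord_complete :: "'a set \<Rightarrow> ('a \<Rightarrow> 'a \<Rightarrow> real) \<Rightarrow> ('a \<Rightarrow> 'a \<Rightarrow> bool) \<Rightarrow> bool" where
  "ord_complete M d le \<longleftrightarrow>
     (\<forall>u::nat \<Rightarrow> 'a. range u \<subseteq> M \<longrightarrow> monotone (\<le>) le u \<longrightarrow> Metric_space.MCauchy M d u \<longrightarrow>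
        (\<exists>l. limitin (Metric_space.mtopology M d) u l sequentially))"

definition self_closed :: "'a set \<Rightarrow> ('a \<Rightarrow> 'a \<Rightarrow> real) \<Rightarrow> ('a \<Rightarrow> 'a \<Rightarrow> bool) \<Rightarrow> bool" where
  "self_closed M d le \<longleftrightarrow>
     (\<forall>(u::nat \<Rightarrow> 'a) l. range u \<subseteq> M \<longrightarrow> monotone (\<le>) le u \<longrightarrow>
        limitin (Metric_space.mtopology M d) u l sequentially \<longrightarrow> (\<forall>n. le (u n) l))"

definition Delta :: "('q::finite \<Rightarrow> 'a \<Rightarrow> 'a \<Rightarrow> real) \<Rightarrow> ('q \<Rightarrow> 'a) \<Rightarrow> ('q \<Rightarrow> 'a) \<Rightarrow> real ^ 'q" where
  "Delta d x y = (\<chi> i. d i (x i) (y i))"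

definition prod_le :: "('q \<Rightarrow> 'a \<Rightarrow> 'a \<Rightarrow> bool) \<Rightarrow> ('q \<Rightarrow> 'a) \<Rightarrow> ('q \<Rightarrow> 'a) \<Rightarrow> bool" where
  "prod_le le x y \<longleftrightarrow> (\<forall>i. le i (x i) (y i))"

definition Delta_converges ::
  "('q::finite \<Rightarrow> 'a \<Rightarrow> 'a \<Rightarrow> real) \<Rightarrow> (nat \<Rightarrow> 'q \<Rightarrow> 'a) \<Rightarrow> ('q \<Rightarrow> 'a) \<Rightarrow> bool" where
  "Delta_converges d xs x \<longleftrightarrow> (\<lambda>n. Delta d (xs n) x) \<longlonglongrightarrow> 0"

definition Delta_continuous ::
  "('q::finite \<Rightarrow> 'a set) \<Rightarrow> ('q \<Rightarrow> 'a \<Rightarrow> 'a \<Rightarrow> real) \<Rightarrow> ('q \<Rightarrow> 'a \<Rightarrow> 'a \<Rightarrow> bool) \<Rightarrow>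
   'q \<Rightarrow> (('q \<Rightarrow> 'a) \<Rightarrow> 'a) \<Rightarrow> bool" where
  "Delta_continuous X d le i F \<longleftrightarrow>
     (\<forall>xs x. range xs \<subseteq> Pi UNIV X \<longrightarrow> x \<in> Pi UNIV X \<longrightarrow> monotone (\<le>) (prod_le le) xs \<longrightarrow>
        Delta_converges d xs x \<longrightarrow> (\<lambda>n. d i (F (xs n)) (F x)) \<longlonglongrightarrow> 0)"

text \<open>The relation \<open><\<close> on \<open>real ^ 'q\<close> is not componentwise, so \<open>z > 0\<close> is spelled out.\<close>

definition nu :: "real ^ 'q ^ 'q \<Rightarrow> real" where
  "nu A = Inf {c. 0 \<le> c \<and> (\<exists>z::real ^ 'q. (\<forall>i. 0 < z $ i) \<and> A *v z \<le> c *\<^sub>R z)}"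

definition normal_matrix :: "real ^ 'q ^ 'q \<Rightarrow> bool" where
  "normal_matrix A \<longleftrightarrow> (\<forall>i j. 0 \<le> A $ i $ j) \<and> nu A < 1"

definition Picard_operator ::
  "('q::finite \<Rightarrow> 'a set) \<Rightarrow> ('q \<Rightarrow> 'a \<Rightarrow> 'a \<Rightarrow> real) \<Rightarrow> ('q \<Rightarrow> 'a \<Rightarrow> 'a \<Rightarrow> bool) \<Rightarrow>
   (('q \<Rightarrow> 'a) \<Rightarrow> ('q \<Rightarrow> 'a)) \<Rightarrow> bool" where
  "Picard_operator X d le T \<longleftrightarrow>
     (\<forall>x\<in>Pi UNIV X. prod_le le x (T x) \<longrightarrow>
        (\<exists>z\<in>Pi UNIV X. Delta_converges d (\<lambda>n. (T ^^ n) x) z) \<and>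
        (\<forall>z\<in>Pi UNIV X. Delta_converges d (\<lambda>n. (T ^^ n) x) z \<longrightarrow> z = T z))"

end

theory Submission
  imports Defs
begin

text \<open>
  Normality gives \<open>z > 0\<close> and \<open>c < 1\<close> with \<open>A z \<le> c z\<close>. Scaling \<open>z\<close> so that it dominates
  \<open>\<Delta>(x, Tx)\<close>, monotonicity and the contraction condition yield \<open>\<Delta>(T\<^sup>n x, T\<^sup>n\<^sup>+\<^sup>1 x) \<le> c\<^sup>n z\<close>. Each
  component of the orbit is thus an ascending Cauchy sequence and converges. Both alternatives of
  the last hypothesis make \<open>d\<^sub>i(T\<^sub>i(T\<^sup>n x), T\<^sub>i z)\<close> tend to 0 for the limit \<open>z\<close>, so \<open>z = T z\<close> by
  uniqueness of limits.
\<close>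

text \<open>An infimum below \<open>b\<close> need not be attained, but some member of the set lies
  below \<open>b\<close>. With \<open>b = 1\<close> this supplies the contraction constant
  \<open>c\<close> and the positive weight vector \<open>z\<close>.\<close>

lemma nu_less_obtain:
  fixes A :: "real ^ 'q ^ 'q"
  assumes "nu A < b"
  obtains c z where "0 \<le> c" "c < b" "\<And>i. 0 < z $ i" "A *v z \<le> c *\<^sub>R z"
proof -
  let ?S = "{c. 0 \<le> c \<and> (\<exists>z::real ^ 'q. (\<forall>i. 0 < z $ i) \<and> A *v z \<le> c *\<^sub>R z)}"
  \<comment> \<open>The infimum is a junk value unless the set is nonempty: the sum of all
    absolute entries is a member, witnessed by the all-ones vector.\<close>
  define K where "K = (\<Sum>i\<in>UNIV. \<Sum>j\<in>UNIV. \<bar>A $ i $ j\<bar>)"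
  have row: "(\<Sum>j\<in>UNIV. A $ i $ j) \<le> K" for i
  proof -
    have "(\<Sum>j\<in>UNIV. A $ i $ j) \<le> (\<Sum>j\<in>UNIV. \<bar>A $ i $ j\<bar>)"
      by (rule sum_mono) simp
    also have "\<dots> \<le> K"
      unfolding K_def by (rule member_le_sum) (auto intro: sum_nonneg)
    finally show ?thesis .
  qed
  have "0 \<le> K"
    unfolding K_def by (intro sum_nonneg) simp
  moreover have "A *v 1 \<le> K *\<^sub>R 1"
    using row by (simp add: less_eq_vec_def matrix_vector_mult_def)
  ultimately have "K \<in> ?S"
    by (auto intro!: exI[of _ "1 :: real ^ 'q"])
  then have "?S \<noteq> {}" by blast
  then obtain c where "c \<in> ?S" "c < b"
    using assms cInf_lessD[of ?S b] by (auto simp: nu_def)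
  then show ?thesis using that by blast
qed

lemma (in Metric_space) MCauchy_geometric:
  assumes X: "range u \<subseteq> M"
    and c: "0 \<le> c" "c < 1"
    and step: "\<And>n. d (u n) (u (Suc n)) \<le> C * c ^ n"
  shows "MCauchy u"
proof -
  \<comment> \<open>\<open>B\<close> is the sum of the series with terms \<open>C * c ^ n\<close>,
    so \<open>C * c ^ n = B * (c ^ n - c ^ Suc n)\<close> and the step bounds telescope.\<close>
  define B where "B = C / (1 - c)"
  have uM: "u n \<in> M" for n using X by blast
  have C: "C = B * (1 - c)" using c by (simp add: B_def)
  have "0 \<le> C" using order_trans[OF nonneg step[of 0]] by simp
  then have B: "0 \<le> B" using c by (simp add: B_def)
  \<comment> \<open>The exact difference is kept because the weaker bound \<open>B * c ^ n\<close>
    would not survive the induction on \<open>k\<close>.\<close>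
  have telescope: "d (u n) (u (n + k)) \<le> B * (c ^ n - c ^ (n + k))" for n k
  proof (induction k)
    case 0
    show ?case using uM by simp
  next
    case (Suc k)
    have "d (u n) (u (n + Suc k)) \<le> d (u n) (u (n + k)) + d (u (n + k)) (u (Suc (n + k)))"
      using triangle[OF uM uM uM] by simp
    also have "\<dots> \<le> B * (c ^ n - c ^ (n + k)) + B * (1 - c) * c ^ (n + k)"
      using Suc step[of "n + k"] by (simp add: C)
    also have "\<dots> = B * (c ^ n - c ^ (n + Suc k))"
      by (simp add: algebra_simps)
    finally show ?case .
  qed
  have le: "d (u n) (u m) \<le> B * c ^ n" if "n \<le> m" for n m
  proof -
    have "d (u n) (u m) \<le> B * (c ^ n - c ^ m)"
      using telescope[of n "m - n"] that by simp
    also have "\<dots> \<le> B * c ^ n"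
      using B c by (intro mult_left_mono) auto
    finally show ?thesis .
  qed
  show ?thesis
    unfolding MCauchy_def
  proof (intro conjI allI impI X)
    fix \<epsilon> :: real assume "\<epsilon> > 0"
    have "(\<lambda>n. B * c ^ n) \<longlonglongrightarrow> B * 0"
      using c by (intro tendsto_intros LIMSEQ_power_zero) auto
    then have "\<forall>\<^sub>F n in sequentially. B * c ^ n < \<epsilon>"
      using \<open>\<epsilon> > 0\<close> by (auto dest: order_tendstoD)
    then obtain N where N: "\<And>n. n \<ge> N \<Longrightarrow> B * c ^ n < \<epsilon>"
      by (auto simp: eventually_sequentially)
    have "d (u n) (u m) < \<epsilon>" if "N \<le> n" "N \<le> m" for n m
    proof (cases "n \<le> m")
      case True
      then show ?thesis using le[OF True] N[OF that(1)] by linarith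
    next
      case False
      then show ?thesis using le[of m n] N[OF that(2)] commute[of "u n" "u m"] by linarith
    qed
    then show "\<exists>N. \<forall>n n'. N \<le> n \<longrightarrow> N \<le> n' \<longrightarrow> d (u n) (u n') < \<epsilon>" by blast
  qed
qed

text \<open>Bridges the topological limits in \<open>ord_complete\<close> and
  \<open>self_closed\<close> and the real null sequences behind \<open>Delta_converges\<close>. The
  range assumption settles the membership clause of the metric limit.\<close>

lemma (in Metric_space) limitin_dist_zero_iff:
  assumes "range u \<subseteq> M"
  shows "limitin mtopology u l sequentially \<longleftrightarrow> l \<in> M \<and> (\<lambda>n. d (u n) l) \<longlonglongrightarrow> 0"
  using assms unfolding limit_metric_sequentially LIMSEQ_iff by (auto simp: subset_iff)

lemma (in Metric_space) dist_zero_limit_unique: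
  assumes "range u \<subseteq> M" "k \<in> M" "l \<in> M" "(\<lambda>n. d (u n) k) \<longlonglongrightarrow> 0" "(\<lambda>n. d (u n) l) \<longlonglongrightarrow> 0"
  shows "k = l"
  using assms limitin_metric_unique[of u k sequentially l] by (simp add: limitin_dist_zero_iff)

lemma Delta_converges_iff:
  "Delta_converges d xs x \<longleftrightarrow> (\<forall>i. (\<lambda>n. d i (xs n i) (x i)) \<longlonglongrightarrow> 0)"
proof
  assume "Delta_converges d xs x"
  then show "\<forall>i. (\<lambda>n. d i (xs n i) (x i)) \<longlonglongrightarrow> 0"
    using tendsto_vec_nth[of "\<lambda>n. Delta d (xs n) x" 0 sequentially]
    by (simp add: Delta_converges_def Delta_def)
next
  assume "\<forall>i. (\<lambda>n. d i (xs n i) (x i)) \<longlonglongrightarrow> 0"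
  then show "Delta_converges d xs x"
    unfolding Delta_converges_def by (intro vec_tendstoI) (simp add: Delta_def)
qed

text \<open>\<open>le\<close> is a quasi-order only on \<open>M\<close>: reflexivity in the base
  case and transitivity in the induction step both rely on \<open>u\<close> staying in
  \<open>M\<close>.\<close>

lemma monotone_nat_stepI:
  assumes "range u \<subseteq> M" "reflp_on M le" "transp_on M le" "\<And>n::nat. le (u n) (u (Suc n))"
  shows "monotone (\<le>) le u"
proof (rule monotoneI)
  fix n m :: nat assume "n \<le> m"
  then show "le (u n) (u m)"
  proof (induction rule: dec_induct)
    case base
    show ?case using assms by (auto dest: reflp_onD)
  next
    case (step k)
    then show ?case
      using assms(1) assms(4)[of k] transp_onD[OF assms(3), of "u n" "u k" "u (Suc k)"] by auto
  qed
qed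

theorem theorem4:
  fixes X :: "'q::finite \<Rightarrow> 'a set"
    and d :: "'q \<Rightarrow> 'a \<Rightarrow> 'a \<Rightarrow> real"
    and le :: "'q \<Rightarrow> 'a \<Rightarrow> 'a \<Rightarrow> bool"
    and T :: "'q \<Rightarrow> ('q \<Rightarrow> 'a) \<Rightarrow> 'a"
  assumes "\<And>i. Metric_space (X i) (d i)"
    and "\<And>i. reflp_on (X i) (le i)"
    and "\<And>i. transp_on (X i) (le i)"
    and "\<And>i. T i \<in> Pi UNIV X \<rightarrow> X i"
    and "\<exists>a\<in>Pi UNIV X. \<forall>i. le i (a i) (T i a)"
    and "\<And>i x y. x \<in> Pi UNIV X \<Longrightarrow> y \<in> Pi UNIV X \<Longrightarrow> prod_le le x y \<Longrightarrow> le i (T i x) (T i y)"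
    and "\<And>i. ord_complete (X i) (d i) (le i)"
    and "\<exists>A :: real ^ 'q ^ 'q. normal_matrix A \<and>
           (\<forall>i. \<forall>x\<in>Pi UNIV X. \<forall>y\<in>Pi UNIV X. prod_le le x y \<longrightarrow>
              d i (T i x) (T i y) \<le> (\<Sum>j\<in>UNIV. A $ i $ j * d j (x j) (y j)))"
    and "(\<forall>i. Delta_continuous X d le i (T i)) \<or> (\<forall>i. self_closed (X i) (d i) (le i))"
  shows "Picard_operator X d le (\<lambda>x i. T i x)"
proof -
  define F where "F = (\<lambda>x i. T i x)"
  obtain A :: "real ^ 'q ^ 'q" where A: "normal_matrix A"
    and contr: "\<And>i x y. x \<in> Pi UNIV X \<Longrightarrow> y \<in> Pi UNIV X \<Longrightarrow> prod_le le x y \<Longrightarrow>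
              d i (T i x) (T i y) \<le> (\<Sum>j\<in>UNIV. A $ i $ j * d j (x j) (y j))"
    using assms(8) by blast
  have Anonneg: "0 \<le> A $ i $ j" for i j
    using A by (simp add: normal_matrix_def)
  have "nu A < 1"
    using A by (simp add: normal_matrix_def)
  then obtain c z where c: "0 \<le> c" "c < 1" and z: "\<And>i. 0 < z $ i" and Az: "A *v z \<le> c *\<^sub>R z"
    using nu_less_obtain by blast
  have Az': "(\<Sum>j\<in>UNIV. A $ i $ j * z $ j) \<le> c * z $ i" for i
    using Az by (simp add: less_eq_vec_def matrix_vector_mult_def)
  have "(\<exists>w\<in>Pi UNIV X. Delta_converges d (\<lambda>n. (F ^^ n) x) w) \<and>
        (\<forall>w\<in>Pi UNIV X. Delta_converges d (\<lambda>n. (F ^^ n) x) w \<longrightarrow> w = F w)"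
    if x: "x \<in> Pi UNIV X" and xF: "prod_le le x (F x)" for x
  proof -
    define u where "u n = (F ^^ n) x" for n
    have u_Suc: "u (Suc n) = F (u n)" for n by (simp add: u_def)
    have FX: "F y \<in> Pi UNIV X" if "y \<in> Pi UNIV X" for y
      using assms(4) that by (auto simp: F_def)
    have uX: "u n \<in> Pi UNIV X" for n
      by (induction n) (simp_all add: u_Suc FX, simp add: u_def x)
    have ui: "range (\<lambda>n. u n i) \<subseteq> X i" for i
      using uX by (auto simp: Pi_iff)
    \<comment> \<open>The contraction condition concerns comparable points only; this makes it
      applicable to consecutive iterates.\<close>
    have asc: "prod_le le (u n) (u (Suc n))" for n
    proof (induction n)
      case 0
      show ?case using xF by (simp add: u_def)
    next
      case (Suc n)
      then show ?case
        using assms(6)[OF uX uX Suc] by (simp add: u_Suc[of n] u_Suc[of "Suc n"] F_def prod_le_def)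
    qed
    have mono: "monotone (\<le>) (le i) (\<lambda>n. u n i)" for i
      using asc by (intro monotone_nat_stepI[OF ui assms(2,3)]) (simp add: prod_le_def)
    have nonneg: "0 \<le> d i a b" for i a b
      using assms(1) by (rule Metric_space.nonneg)
    \<comment> \<open>\<open>K\<close> is chosen so that \<open>K * z $ i\<close> dominates the
      first displacement in every coordinate: a sum of nonnegative quotients bounds each of
      them.\<close>
    define K where "K = (\<Sum>j\<in>UNIV. d j (u 0 j) (u 1 j) / z $ j)"
    \<comment> \<open>The coordinate \<open>i\<close> stays arbitrary in the induction, since row
      \<open>i\<close> of \<open>A\<close> draws on the bounds for all coordinates \<open>j\<close>;
      \<open>Az'\<close> then turns the row sum into a single factor \<open>c\<close>.\<close>
    have geom: "d i (u n i) (u (Suc n) i) \<le> K * z $ i * c ^ n" for n i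
    proof (induction n arbitrary: i)
      case 0
      have "d i (u 0 i) (u 1 i) / z $ i \<le> K"
        unfolding K_def using nonneg z by (intro member_le_sum) (auto simp: less_imp_le)
      then show ?case using z[of i] by (simp add: field_simps)
    next
      case (Suc n)
      have "d i (u (Suc n) i) (u (Suc (Suc n)) i)
          \<le> (\<Sum>j\<in>UNIV. A $ i $ j * d j (u n j) (u (Suc n) j))"
        using contr[OF uX uX asc, of i n] by (simp add: u_Suc[of n] u_Suc[of "Suc n"] F_def)
      also have "\<dots> \<le> (\<Sum>j\<in>UNIV. A $ i $ j * (K * z $ j * c ^ n))"
        by (intro sum_mono mult_left_mono Suc Anonneg)
      also have "\<dots> = K * c ^ n * (\<Sum>j\<in>UNIV. A $ i $ j * z $ j)"
        by (simp add: sum_distrib_left mult_ac)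
      also have "\<dots> \<le> K * c ^ n * (c * z $ i)"
      proof (rule mult_left_mono[OF Az'])
        show "0 \<le> K * c ^ n"
          unfolding K_def using nonneg z c
          by (intro mult_nonneg_nonneg sum_nonneg) (auto simp: less_imp_le)
      qed
      finally show ?case by (simp add: mult_ac)
    qed
    have "\<exists>l. limitin (Metric_space.mtopology (X i) (d i)) (\<lambda>n. u n i) l sequentially" for i
      using assms(7)[of i, unfolded ord_complete_def, rule_format, OF ui mono]
        Metric_space.MCauchy_geometric[OF assms(1) ui c geom] .
    then obtain w where w:
      "\<And>i. limitin (Metric_space.mtopology (X i) (d i)) (\<lambda>n. u n i) (w i) sequentially"
      by metis
    then have "w \<in> Pi UNIV X" "Delta_converges d u w"
      using Metric_space.limitin_dist_zero_iff[OF assms(1) ui]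
      by (auto simp: Delta_converges_iff)
    \<comment> \<open>\<open>Picard_operator\<close> demands the fixed point property of every limit
      in the product, so \<open>v\<close> is arbitrary rather than the constructed
      \<open>w\<close>.\<close>
    moreover have "v = F v" if v: "v \<in> Pi UNIV X" and conv: "Delta_converges d u v" for v
    proof
      fix i
      have lim: "(\<lambda>n. d j (u n j) (v j)) \<longlonglongrightarrow> 0" for j
        using conv by (simp add: Delta_converges_iff)
      have "(\<lambda>n. d i (T i (u n)) (T i v)) \<longlonglongrightarrow> 0"
        using assms(9)
      proof
        assume "\<forall>i. Delta_continuous X d le i (T i)"
        moreover have "monotone (\<le>) (prod_le le) u"
          using mono by (auto simp: monotone_on_def prod_le_def)
        moreover have "range u \<subseteq> Pi UNIV X"
          using uX by blast
        ultimately show ?thesis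
          using v conv by (simp add: Delta_continuous_def)
      next
        assume sc: "\<forall>i. self_closed (X i) (d i) (le i)"
        \<comment> \<open>Self-closedness places \<open>v\<close> above the whole orbit, so the
          contraction condition applies to the pair \<open>u n\<close>, \<open>v\<close>.\<close>
        have "le j (u n j) (v j)" for j n
        proof -
          have "limitin (Metric_space.mtopology (X j) (d j)) (\<lambda>n. u n j) (v j) sequentially"
            using Metric_space.limitin_dist_zero_iff[OF assms(1) ui] lim v by (auto simp: Pi_iff)
          then show ?thesis
            by (rule sc[unfolded self_closed_def, rule_format, OF ui mono])
        qed
        then have bound: "d i (T i (u n)) (T i v) \<le> (\<Sum>j\<in>UNIV. A $ i $ j * d j (u n j) (v j))" for n
          using contr[OF uX v] by (simp add: prod_le_def)
        have "(\<lambda>n. \<Sum>j\<in>UNIV. A $ i $ j * d j (u n j) (v j)) \<longlonglongrightarrow> (\<Sum>j\<in>UNIV. A $ i $ j * 0)"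
          by (intro tendsto_intros lim)
        then have upper: "(\<lambda>n. \<Sum>j\<in>UNIV. A $ i $ j * d j (u n j) (v j)) \<longlonglongrightarrow> 0"
          by simp
        show ?thesis
          by (rule tendsto_sandwich[OF _ _ tendsto_const upper]) (simp_all add: nonneg bound)
      qed
      then have "(\<lambda>n. d i (u (Suc n) i) (F v i)) \<longlonglongrightarrow> 0"
        by (simp add: u_Suc F_def)
      \<comment> \<open>Undoing the index shift shows that the same sequence \<open>u n i\<close>
        tends to both \<open>v i\<close> and \<open>F v i\<close>.\<close>
      then have limF: "(\<lambda>n. d i (u n i) (F v i)) \<longlonglongrightarrow> 0"
        by (rule LIMSEQ_imp_Suc)
      have "v i \<in> X i" "F v i \<in> X i"
        using v FX[OF v] by auto
      then show "v i = F v i"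
        using lim[of i] limF by (rule Metric_space.dist_zero_limit_unique[OF assms(1)[of i] ui[of i]])
    qed
    ultimately show ?thesis unfolding u_def by blast
  qed
  then show ?thesis unfolding Picard_operator_def F_def by blast
qed

end
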